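(* The following two assertions are equivalent. (1) For any $t\in\mathbb{C}$, the subspace $\xi\mathbb{C}[\xi,z]:=\sum_{i=1}^n\xi_i\mathbb{C}[\xi,z]$ of $\mathcal{B}_t[\xi,z]$ is a Mathieu subspace of the algebra $\mathcal{B}_t[\xi,z]$. (2) For any $t\in\mathbb{C}$, the subspace $\mathrm{Im}(\xi-t\partial):=\sum_{i=1}^n(\xi_i-t\partial_i)\mathbb{C}[\xi,z]$ is a Mathieu subspace of the polynomial algebra $\mathcal{A}[\xi,z]$.
   Context: Let $\xi=(\xi_1,\dots,\xi_n)$ and $z=(z_1,\dots,z_n)$ be $2n$ commuting free variables, $\partial_i=\partial/\partial z_i$, $\delta_i=\partial/\partial\xi_i$. $\mathcal{A}[\xi,z]$ is the vector space $\mathbb{C}[\xi,z]$ with the usual polynomial multiplication. For $t\in\mathbb{C}$, $\mathcal{B}_t[\xi,z]$ is the vector space $\mathbb{C}[\xi,z]$ with the product $f\ast_t g:=\mu\big(e^{-t\Omega}(f\otimes g)\big)$, where $\Omega=\sum_{i=1}^n(\partial_i\otimes\delta_i+\delta_i\otimes\partial_i)$ and $\mu(f\otimes g)=fg$ is the usual multiplication; it is a commutative algebra. In $\xi_i\mathbb{C}[\xi,z]$ the product is the usual product of polynomials, and $(\xi_i-t\partial_i)\mathbb{C}[\xi,z]$ is the image of the differential operator $\xi_i-t\partial_i$ on $\mathbb{C}[\xi,z]$. Mathieu subspace: for a commutative ring $R$ and a commutative $R$-algebra $A$, an $R$-subspace $M\subseteq A$ is a Mathieu subspace of $A$ if whenever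 $a\in A$ satisfies $a^m\in M$ for all $m\ge1$, then for every $b\in A$ there is $N\ge1$ (depending on $a$ and $b$) such that $b\,a^m\in M$ for all $m\ge N$ (products and powers in $A$). *)

theory Defs
  imports Complex_Main "HOL-Library.Poly_Mapping" "HOL-Algebra.Module"
begin

section \<open>The polynomial ring in \<open>\<xi>\<^sub>i\<close>, \<open>z\<^sub>i\<close>\<close>

text \<open>The index set \<open>{1,\<dots>,n}\<close> is rendered by a type \<open>'n\<close> of class \<^class>\<open>finite\<close>, \<open>n = CARD('n) \<ge> 1\<close>.\<close>

datatype 'n pvar = Xi 'n | Zv 'n

type_synonym 'n mono = "'n pvar \<Rightarrow>\<^sub>0 nat"

text \<open>\<open>\<complex>[\<xi>,z]\<close> as the monoid algebra of the free commutative monoid on the \<open>2n\<close> variables; the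
  type class operations \<open>+\<close>, \<open>*\<close>, \<open>1\<close> are the usual polynomial ones.\<close>

type_synonym 'n cpoly = "'n mono \<Rightarrow>\<^sub>0 complex"

definition scal :: "complex \<Rightarrow> ('k \<Rightarrow>\<^sub>0 complex) \<Rightarrow> ('k \<Rightarrow>\<^sub>0 complex)" where
  "scal c p = Poly_Mapping.map ((*) c) p"

text \<open>\<open>'k \<Rightarrow>\<^sub>0 complex\<close> is the vector space with basis \<open>'k\<close>; \<open>lin_ext f\<close> is the linear map that
  extends the function \<open>f\<close> on the basis.\<close>

definition lin_ext :: "('k \<Rightarrow> ('l \<Rightarrow>\<^sub>0 complex)) \<Rightarrow> ('k \<Rightarrow>\<^sub>0 complex) \<Rightarrow> ('l \<Rightarrow>\<^sub>0 complex)" where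
  "lin_ext f p = (\<Sum>m\<in>Poly_Mapping.keys p. scal (Poly_Mapping.lookup p m) (f m))"

definition monom :: "'k \<Rightarrow> ('k \<Rightarrow>\<^sub>0 complex)" where
  "monom m = Poly_Mapping.single m 1"

definition Var :: "'n pvar \<Rightarrow> 'n cpoly" where
  "Var v = monom (Poly_Mapping.single v 1)"

text \<open>Subtraction on exponents is truncated, but if \<open>v\<close> does not occur in \<open>m\<close> then the coefficient
  \<open>Poly_Mapping.lookup m v\<close> vanishes.\<close>

definition pderiv_var :: "'n pvar \<Rightarrow> 'n cpoly \<Rightarrow> 'n cpoly" where
  "pderiv_var v =
     lin_ext (\<lambda>m. scal (of_nat (Poly_Mapping.lookup m v)) (monom (m - Poly_Mapping.single v 1)))"

abbreviation dz :: "'n \<Rightarrow> 'n cpoly \<Rightarrow> 'n cpoly" where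
  "dz i \<equiv> pderiv_var (Zv i)"

abbreviation dxi :: "'n \<Rightarrow> 'n cpoly \<Rightarrow> 'n cpoly" where
  "dxi i \<equiv> pderiv_var (Xi i)"


section \<open>The product \<open>\<ast>\<^sub>t\<close>\<close>

text \<open>The tensor product of the spaces with bases \<open>'k\<close> and \<open>'l\<close> is the space with basis
  \<open>'k \<times> 'l\<close>, the pair \<open>(a, b)\<close> standing for \<open>a \<otimes> b\<close>.\<close>

type_synonym 'n cpoly2 = "('n mono \<times> 'n mono) \<Rightarrow>\<^sub>0 complex"

definition tensor :: "('k \<Rightarrow>\<^sub>0 complex) \<Rightarrow> ('l \<Rightarrow>\<^sub>0 complex) \<Rightarrow> (('k \<times> 'l) \<Rightarrow>\<^sub>0 complex)" where
  "tensor f g = (\<Sum>a\<in>Poly_Mapping.keys f. \<Sum>b\<in>Poly_Mapping.keys g. Poly_Mapping.single (a, b) (Poly_Mapping.lookup f a * Poly_Mapping.lookup g b))"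

text \<open>The operator \<open>A \<otimes> B\<close> for linear \<open>A\<close>, \<open>B\<close>.\<close>

definition tensor_op ::
    "('n cpoly \<Rightarrow> 'n cpoly) \<Rightarrow> ('n cpoly \<Rightarrow> 'n cpoly) \<Rightarrow> 'n cpoly2 \<Rightarrow> 'n cpoly2" where
  "tensor_op A B = lin_ext (\<lambda>(a, b). tensor (A (monom a)) (B (monom b)))"

definition mu :: "'n cpoly2 \<Rightarrow> 'n cpoly" where
  "mu = lin_ext (\<lambda>(a, b). monom a * monom b)"

definition Omega :: "'n::finite cpoly2 \<Rightarrow> 'n cpoly2" where
  "Omega T = (\<Sum>i\<in>UNIV. tensor_op (dz i) (dxi i) T + tensor_op (dxi i) (dz i) T)"

text \<open>\<open>Sum_any\<close> sums over the indices with nonzero summand. These are finitely many, since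
  \<^const>\<open>Omega\<close> is locally nilpotent (lemma \<open>finite_exp_Omega\<close> below).\<close>

definition exp_Omega :: "complex \<Rightarrow> 'n::finite cpoly2 \<Rightarrow> 'n cpoly2" where
  "exp_Omega c T = Sum_any (\<lambda>k::nat. scal (c ^ k / fact k) ((Omega ^^ k) T))"

definition star :: "complex \<Rightarrow> 'n::finite cpoly \<Rightarrow> 'n cpoly \<Rightarrow> 'n cpoly" where
  "star t f g = mu (exp_Omega (- t) (tensor f g))"


section \<open>The algebras and Mathieu subspaces\<close>

definition complex_field :: "complex ring" where
  "complex_field = \<lparr>carrier = UNIV, monoid.mult = (*), one = 1, zero = 0, add = (+)\<rparr>"

definition A_alg :: "(complex, 'n cpoly) module" where
  "A_alg = \<lparr>carrier = UNIV, monoid.mult = (*), one = 1, zero = 0, add = (+), smult = scal\<rparr>"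

definition B_alg :: "complex \<Rightarrow> (complex, 'n::finite cpoly) module" where
  "B_alg t = \<lparr>carrier = UNIV, monoid.mult = star t, one = 1, zero = 0, add = (+), smult = scal\<rparr>"

text \<open>To be used for a commutative ring \<open>R\<close> and a commutative \<open>R\<close>-algebra \<open>A\<close>.\<close>

definition mathieu_subspace :: "('r, 's) ring_scheme \<Rightarrow> ('r, 'a, 'c) module_scheme \<Rightarrow> 'a set \<Rightarrow> bool"
  where
  "mathieu_subspace R A M \<longleftrightarrow>
     submodule M R A \<and>
     (\<forall>a\<in>carrier A. (\<forall>m\<ge>1::nat. a [^]\<^bsub>A\<^esub> m \<in> M) \<longrightarrow>
        (\<forall>b\<in>carrier A. \<exists>N\<ge>1::nat. \<forall>m\<ge>N. b \<otimes>\<^bsub>A\<^esub> (a [^]\<^bsub>A\<^esub> m) \<in> M))"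

definition xi_subspace :: "'n::finite cpoly set" where
  "xi_subspace = {\<Sum>i\<in>UNIV. Var (Xi i) * f i | f :: 'n \<Rightarrow> 'n cpoly. True}"

definition Im_subspace :: "complex \<Rightarrow> 'n::finite cpoly set" where
  "Im_subspace t = {\<Sum>i\<in>UNIV. Var (Xi i) * f i - scal t (dz i (f i)) | f :: 'n \<Rightarrow> 'n cpoly. True}"


section \<open>Local nilpotency of \<open>\<Omega>\<close>\<close>

instance pvar :: (finite) finite
proof
  have "(UNIV :: 'a pvar set) = Xi ` UNIV \<union> Zv ` UNIV"
    by (metis UNIV_eq_I UnCI pvar.exhaust rangeI)
  then show "finite (UNIV :: 'a pvar set)" by (metis finite finite_UnI finite_imageI)
qed

lemma lookup_scal [simp]: "Poly_Mapping.lookup (scal c p) k = c * Poly_Mapping.lookup p k"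
  by (simp add: scal_def Poly_Mapping.map.rep_eq when_def)

lemma keys_scal: "Poly_Mapping.keys (scal c p) \<subseteq> Poly_Mapping.keys p"
  by (auto simp: in_keys_iff)

lemma scal_0 [simp]: "scal c 0 = 0"
  by (rule poly_mapping_eqI) simp

lemma keys_lin_ext:
  "Poly_Mapping.keys (lin_ext f p) \<subseteq> (\<Union>m\<in>Poly_Mapping.keys p. Poly_Mapping.keys (f m))"
proof -
  have "Poly_Mapping.keys (lin_ext f p)
      \<subseteq> (\<Union>m\<in>Poly_Mapping.keys p. Poly_Mapping.keys (scal (Poly_Mapping.lookup p m) (f m)))"
    unfolding lin_ext_def by (rule keys_sum)
  then show ?thesis by (rule order_trans) (intro UN_mono order_refl keys_scal)
qed

lemma keys_tensor:
  "Poly_Mapping.keys (tensor f g) \<subseteq> Poly_Mapping.keys f \<times> Poly_Mapping.keys g"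
proof
  fix k assume k: "k \<in> Poly_Mapping.keys (tensor f g)"
  obtain a where a: "a \<in> Poly_Mapping.keys f" and "k \<in> Poly_Mapping.keys
      (\<Sum>b\<in>Poly_Mapping.keys g. Poly_Mapping.single (a, b)
         (Poly_Mapping.lookup f a * Poly_Mapping.lookup g b))"
    using subsetD[OF keys_sum k[unfolded tensor_def]] by blast
  from subsetD[OF keys_sum this(2)] obtain b where "b \<in> Poly_Mapping.keys g" "k \<in> Poly_Mapping.keys
      (Poly_Mapping.single (a, b) (Poly_Mapping.lookup f a * Poly_Mapping.lookup g b))"
    by blast
  then show "k \<in> Poly_Mapping.keys f \<times> Poly_Mapping.keys g"
    using a by (auto split: if_splits)
qed

definition deg_mono :: "'n::finite mono \<Rightarrow> nat" where
  "deg_mono m = (\<Sum>v\<in>UNIV. Poly_Mapping.lookup m v)"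

definition ldeg_less :: "nat \<Rightarrow> 'n::finite cpoly2 \<Rightarrow> bool" where
  "ldeg_less d T \<longleftrightarrow> (\<forall>(a, b)\<in>Poly_Mapping.keys T. deg_mono a < d)"

lemma keys_pderiv_monom:
  assumes "k \<in> Poly_Mapping.keys (pderiv_var v (monom m))"
  shows "deg_mono k < deg_mono m"
proof -
  have "k \<in> Poly_Mapping.keys (scal (of_nat (Poly_Mapping.lookup m v))
      (monom (m - Poly_Mapping.single v 1)))"
    using assms keys_lin_ext unfolding pderiv_var_def monom_def by fastforce
  then have pos: "Poly_Mapping.lookup m v \<noteq> 0" and k: "k = m - Poly_Mapping.single v 1"
    by (auto simp: in_keys_iff monom_def lookup_single when_def split: if_splits)
  have le: "Poly_Mapping.lookup k w \<le> Poly_Mapping.lookup m w" for w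
    by (simp add: k lookup_minus)
  have "Poly_Mapping.lookup k v < Poly_Mapping.lookup m v"
    using pos by (simp add: k lookup_minus)
  then have "\<exists>w\<in>UNIV. Poly_Mapping.lookup k w < Poly_Mapping.lookup m w" by blast
  then show ?thesis
    unfolding deg_mono_def by (intro sum_strict_mono_ex1) (simp_all add: le)
qed

lemma ldeg_less_Omega:
  assumes "ldeg_less (Suc d) T"
  shows "ldeg_less d (Omega T)"
  unfolding ldeg_less_def
proof clarify
  fix a b assume ab: "(a, b) \<in> Poly_Mapping.keys (Omega T)"
  have step: "deg_mono a < d"
    if ab': "(a, b) \<in> Poly_Mapping.keys (tensor_op (pderiv_var v) (pderiv_var w) T)" for v w
  proof -
    obtain x where x: "x \<in> Poly_Mapping.keys T"
      and "(a, b) \<in> Poly_Mapping.keys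
            (case x of (a', b') \<Rightarrow> tensor (pderiv_var v (monom a')) (pderiv_var w (monom b')))"
      using subsetD[OF keys_lin_ext ab'[unfolded tensor_op_def]] by blast
    then have "(a, b) \<in> Poly_Mapping.keys (pderiv_var v (monom (fst x)))
                       \<times> Poly_Mapping.keys (pderiv_var w (monom (snd x)))"
      unfolding case_prod_unfold by (elim subsetD[OF keys_tensor])
    then have "deg_mono a < deg_mono (fst x)"
      by (auto intro: keys_pderiv_monom)
    moreover have "deg_mono (fst x) < Suc d"
      using assms x by (auto simp: ldeg_less_def)
    ultimately show ?thesis by simp
  qed
  obtain i where "(a, b) \<in> Poly_Mapping.keys
      (tensor_op (dz i) (dxi i) T + tensor_op (dxi i) (dz i) T)"
    using subsetD[OF keys_sum ab[unfolded Omega_def]] by blast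
  from subsetD[OF Poly_Mapping.keys_add this] show "deg_mono a < d"
    using step by blast
qed

lemma Omega_0: "Omega 0 = 0"
  by (simp add: Omega_def tensor_op_def lin_ext_def)

lemma Omega_nilpotent: "\<exists>d. \<forall>k\<ge>d. (Omega ^^ k) T = 0"
proof -
  have *: "(Omega ^^ d) T = 0" if "ldeg_less d T" for d and T :: "'a cpoly2"
    using that
  proof (induction d arbitrary: T)
    case 0
    then show ?case by (auto simp: ldeg_less_def simp flip: keys_eq_empty)
  next
    case (Suc d)
    then show ?case by (simp add: ldeg_less_Omega funpow_Suc_right del: funpow.simps)
  qed
  have "ldeg_less (Suc (\<Sum>(a, b)\<in>Poly_Mapping.keys T. deg_mono a)) T"
    unfolding ldeg_less_def
  proof clarify
    fix a b assume "(a, b) \<in> Poly_Mapping.keys T"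
    then have "(case (a, b) of (a, b) \<Rightarrow> deg_mono a) \<le> (\<Sum>(a, b)\<in>Poly_Mapping.keys T. deg_mono a)"
      by (intro member_le_sum) auto
    then show "deg_mono a < Suc (\<Sum>(a, b)\<in>Poly_Mapping.keys T. deg_mono a)" by simp
  qed
  then obtain d where d: "ldeg_less d T" by blast
  have "ldeg_less k T" if "k \<ge> d" for k
    using d that unfolding ldeg_less_def by fastforce
  then show ?thesis using * by blast
qed

lemma finite_exp_Omega: "finite {k::nat. scal (c ^ k / fact k) ((Omega ^^ k) T) \<noteq> 0}"
proof -
  obtain d where "\<forall>k\<ge>d. (Omega ^^ k) T = 0" using Omega_nilpotent by blast
  then have "{k::nat. scal (c ^ k / fact k) ((Omega ^^ k) T) \<noteq> 0} \<subseteq> {..<d}"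
    by (auto simp: not_le[symmetric])
  then show ?thesis by (rule finite_subset) simp
qed

end

theory Submission
  imports Defs
begin

text \<open>
  Let \<open>\<Lambda> = \<Sum>\<^sub>i \<partial>\<^sub>i \<delta>\<^sub>i\<close>. Both assertions are the same assertion read through the automorphism
  \<open>\<phi>\<^sub>t = e\<^bsup>t\<Lambda>\<^esup>\<close> of the vector space \<open>\<complex>[\<xi>,z]\<close>, which makes sense because \<open>\<Lambda>\<close> lowers the degree.

  First, \<open>\<phi>\<^sub>t\<close> is an isomorphism of algebras from the deformed algebra \<open>\<B>\<^sub>t[\<xi>,z]\<close> to the polynomial
  algebra (\<open>exp_Lambda_star\<close>). Indeed the Leibniz rule, applied twice, says
  \<open>\<Lambda> \<circ> \<mu> = \<mu> \<circ> (\<Lambda> \<otimes> 1 + 1 \<otimes> \<Lambda> + \<Omega>)\<close> (\<open>Lambda_mu\<close>), and the three summands commute. Hence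
  \<open>e\<^bsup>t\<Lambda>\<^esup> \<circ> \<mu> \<circ> e\<^bsup>-t\<Omega>\<^esup> = \<mu> \<circ> e\<^bsup>t(\<Lambda> \<otimes> 1 + 1 \<otimes> \<Lambda>)\<^esup> = \<mu> \<circ> (e\<^bsup>t\<Lambda>\<^esup> \<otimes> e\<^bsup>t\<Lambda>\<^esup>)\<close>:
  the twist in \<open>\<ast>\<^sub>t\<close> exactly cancels the failure of \<open>e\<^bsup>t\<Lambda>\<^esup>\<close> to be multiplicative.

  Second, the commutator of \<open>\<Lambda>\<close> with multiplication by \<open>\<xi>\<^sub>i\<close> is \<open>\<partial>\<^sub>i\<close>, which commutes with \<open>\<Lambda>\<close>, so
  \<open>\<phi>\<^sub>t \<circ> \<xi>\<^sub>i = (\<xi>\<^sub>i + t \<partial>\<^sub>i) \<circ> \<phi>\<^sub>t\<close> (\<open>exp_Lambda_Xi_mult\<close>), and \<open>\<phi>\<^sub>t\<close> carries \<open>\<xi>\<complex>[\<xi>,z]\<close> onto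
  \<open>Im(\<xi> + t\<partial>)\<close> (\<open>exp_Lambda_image_xi_subspace\<close>).

  An isomorphism of algebras carries Mathieu subspaces to Mathieu subspaces
  (\<open>mathieu_subspace_image\<close>). Thus the first assertion at \<open>t\<close> is equivalent to the second at \<open>-t\<close>,
  and it remains to let \<open>t\<close> run through \<open>\<complex>\<close>.
\<close>


section \<open>Linear maps on spaces with a basis\<close>

lemma scal_add_right: "scal c (x + y) = scal c x + scal c y"
  by (rule poly_mapping_eqI) (simp add: lookup_add algebra_simps)

lemma scal_add_left: "scal (c + d) x = scal c x + scal d x"
  by (rule poly_mapping_eqI) (simp add: lookup_add algebra_simps)

lemma scal_scal [simp]: "scal c (scal d x) = scal (c * d) x"
  by (rule poly_mapping_eqI) (simp add: mult.assoc)

lemma scal_one [simp]: "scal 1 x = x"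
  by (rule poly_mapping_eqI) simp

lemma scal_zero_left [simp]: "scal 0 x = 0"
  by (rule poly_mapping_eqI) simp

lemma scal_eq_0_iff: "scal c x = 0 \<longleftrightarrow> c = 0 \<or> x = 0"
  by (auto simp: poly_mapping_eq_iff fun_eq_iff)

lemma scal_minus_left: "scal (- c) x = - scal c x"
  by (rule poly_mapping_eqI) simp

lemma scal_sum: "scal c (\<Sum>i\<in>A. f i) = (\<Sum>i\<in>A. scal c (f i))"
  by (induction A rule: infinite_finite_induct) (auto simp: scal_add_right)

lemma vector_space_scal: "vector_space scal"
  by unfold_locales (simp_all add: scal_add_left scal_add_right)

abbreviation lin :: "(('k \<Rightarrow>\<^sub>0 complex) \<Rightarrow> ('l \<Rightarrow>\<^sub>0 complex)) \<Rightarrow> bool" where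
  "lin \<equiv> Vector_Spaces.linear scal scal"

lemma lin_iff: "lin F \<longleftrightarrow> (\<forall>x y. F (x + y) = F x + F y) \<and> (\<forall>c x. F (scal c x) = scal c (F x))"
  by (simp add: Vector_Spaces.linear_iff vector_space_scal)

lemma linI:
  assumes "\<And>x y. F (x + y) = F x + F y" "\<And>c x. F (scal c x) = scal c (F x)"
  shows "lin F"
  using assms by (simp add: lin_iff)

lemma lin_add: "lin F \<Longrightarrow> F (x + y) = F x + F y"
  and lin_scal: "lin F \<Longrightarrow> F (scal c x) = scal c (F x)"
  by (simp_all add: lin_iff)

lemma lin_0: "lin F \<Longrightarrow> F 0 = 0"
  using lin_scal[of F 0 0] by simp

lemma lin_sum: "lin F \<Longrightarrow> F (\<Sum>i\<in>A. f i) = (\<Sum>i\<in>A. F (f i))"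
  by (induction A rule: infinite_finite_induct) (simp_all add: lin_add lin_0)

lemma lin_scaled: "lin F \<Longrightarrow> lin (\<lambda>x. scal c (F x))"
  by (simp add: lin_iff scal_add_right mult.commute)

lemma lin_plus: "lin F \<Longrightarrow> lin G \<Longrightarrow> lin (\<lambda>x. F x + G x)"
  by (simp add: lin_iff scal_add_right)

lemma lin_sum_fun: "(\<And>i. lin (F i)) \<Longrightarrow> lin (\<lambda>x. \<Sum>i\<in>A. F i x)"
  by (simp add: lin_iff scal_sum sum.distrib)

lemma lin_comp: "lin F \<Longrightarrow> lin G \<Longrightarrow> lin (\<lambda>x. F (G x))"
  by (simp add: lin_iff)

lemma lin_ident: "lin (\<lambda>x. x)"
  by (simp add: lin_iff)

lemma lin_funpow:
  fixes F :: "('k \<Rightarrow>\<^sub>0 complex) \<Rightarrow> ('k \<Rightarrow>\<^sub>0 complex)"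
  shows "lin F \<Longrightarrow> lin (F ^^ k)"
  by (induction k) (simp_all add: lin_iff id_def)

lemma lin_ext_superset:
  assumes "finite S" "Poly_Mapping.keys p \<subseteq> S"
  shows "lin_ext f p = (\<Sum>m\<in>S. scal (Poly_Mapping.lookup p m) (f m))"
  unfolding lin_ext_def using assms
  by (intro sum.mono_neutral_left) (auto simp: in_keys_iff)

lemma lin_lin_ext: "lin (lin_ext f)"
proof (rule linI)
  fix x y :: "'a \<Rightarrow>\<^sub>0 complex" and c
  let ?S = "Poly_Mapping.keys x \<union> Poly_Mapping.keys y"
  have "Poly_Mapping.keys (x + y) \<subseteq> ?S" by (rule Poly_Mapping.keys_add)
  then show "lin_ext f (x + y) = lin_ext f x + lin_ext f y"
    by (simp add: lin_ext_superset[of ?S] lookup_add scal_add_left sum.distrib)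
  show "lin_ext f (scal c x) = scal c (lin_ext f x)"
    using keys_scal[of c x] by (simp add: lin_ext_superset[of "Poly_Mapping.keys x"] scal_sum)
qed

lemma lin_ext_monom [simp]: "lin_ext f (monom m) = f m"
  by (simp add: lin_ext_def monom_def)

lemma lin_ext_monom_id: "lin_ext monom p = p"
  by (rule poly_mapping_eqI)
     (simp add: lin_ext_def lookup_sum monom_def lookup_single when_def in_keys_iff if_distrib sum.delta
        cong: if_cong)

lemma lin_eqI:
  assumes "lin F" "lin G" "\<And>m. F (monom m) = G (monom m)"
  shows "F x = G x"
proof -
  have "F (lin_ext monom x) = G (lin_ext monom x)"
    unfolding lin_ext_def using assms by (simp add: lin_sum lin_scal)
  then show ?thesis by (simp add: lin_ext_monom_id)
qed


section \<open>Exponentials of locally nilpotent operators\<close>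

definition loc_nilp :: "(('k \<Rightarrow>\<^sub>0 complex) \<Rightarrow> ('k \<Rightarrow>\<^sub>0 complex)) \<Rightarrow> bool" where
  "loc_nilp T \<longleftrightarrow> (\<forall>v. \<exists>d. \<forall>k\<ge>d. (T ^^ k) v = 0)"

definition divpow :: "(('k \<Rightarrow>\<^sub>0 complex) \<Rightarrow> ('k \<Rightarrow>\<^sub>0 complex)) \<Rightarrow> nat \<Rightarrow> ('k \<Rightarrow>\<^sub>0 complex) \<Rightarrow> ('k \<Rightarrow>\<^sub>0 complex)" where
  "divpow T k v = scal (1 / fact k) ((T ^^ k) v)"

text \<open>The exponential of \<open>T\<close>. The sum takes the value \<open>0\<close> if infinitely many of its terms are nonzero,
  so it is meaningful for locally nilpotent \<open>T\<close>. The factor \<open>t\<close> of \<open>e\<^bsup>tT\<^esup>\<close> is put into the operator, so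
  that a single addition rule covers both \<open>e\<^bsup>S+T\<^esup>\<close> and \<open>e\<^bsup>(s+t)T\<^esup>\<close>.\<close>

definition op_exp :: "(('k \<Rightarrow>\<^sub>0 complex) \<Rightarrow> ('k \<Rightarrow>\<^sub>0 complex)) \<Rightarrow> ('k \<Rightarrow>\<^sub>0 complex) \<Rightarrow> ('k \<Rightarrow>\<^sub>0 complex)" where
  "op_exp T v = Sum_any (\<lambda>k. divpow T k v)"

lemma op_exp_eq_sum:
  assumes "\<And>k. k \<ge> d \<Longrightarrow> (T ^^ k) v = 0"
  shows "op_exp T v = (\<Sum>k<d. divpow T k v)"
  unfolding op_exp_def
proof (rule Sum_any.expand_superset)
  show "{k. divpow T k v \<noteq> 0} \<subseteq> {..<d}"
    using assms by (force simp: divpow_def not_less[symmetric])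
qed simp

lemma lin_divpow: "lin T \<Longrightarrow> lin (divpow T k)"
  unfolding divpow_def[abs_def] by (intro lin_scaled lin_funpow)

lemma divpow_0 [simp]: "divpow T 0 v = v"
  by (simp add: divpow_def)

lemma divpow_Suc:
  assumes "lin T"
  shows "T (divpow T k v) = scal (of_nat (Suc k)) (divpow T (Suc k) v)"
  using assms by (simp add: divpow_def lin_scal del: of_nat_Suc)

lemma funpow_intertwine:
  assumes "\<And>v. M (S v) = T (M v)"
  shows "M ((S ^^ k) v) = (T ^^ k) (M v)"
  by (induction k) (simp_all add: assms)

text \<open>\<open>M\<close> may change the space: it will be \<open>\<mu>\<close>, which leads from the tensor square back to the
  polynomials, and \<open>f \<mapsto> f \<otimes> h\<close> or \<open>g \<mapsto> h \<otimes> g\<close>, which lead there.\<close>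

lemma op_exp_intertwine:
  assumes M: "lin M" and MS: "\<And>v. M (S v) = T (M v)" and S: "loc_nilp S"
  shows "M (op_exp S v) = op_exp T (M v)"
proof -
  obtain d where d: "\<And>k. k \<ge> d \<Longrightarrow> (S ^^ k) v = 0"
    using S unfolding loc_nilp_def by blast
  have pow: "M ((S ^^ k) v) = (T ^^ k) (M v)" for k
    by (rule funpow_intertwine) (rule MS)
  have "(T ^^ k) (M v) = 0" if "k \<ge> d" for k
    using pow[of k] d[OF that] by (simp add: lin_0[OF M])
  then have "op_exp T (M v) = (\<Sum>k<d. divpow T k (M v))" by (rule op_exp_eq_sum)
  also have "\<dots> = M (\<Sum>k<d. divpow S k v)"
    using M by (simp add: lin_sum divpow_def lin_scal pow)
  also have "(\<Sum>k<d. divpow S k v) = op_exp S v"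
    using d by (rule op_exp_eq_sum[symmetric])
  finally show ?thesis by simp
qed

lemma lin_op_exp:
  assumes T: "lin T" "loc_nilp T"
  shows "lin (op_exp T)"
proof (rule linI)
  fix x y :: "'a \<Rightarrow>\<^sub>0 complex" and c
  obtain d e where d: "\<And>k. k \<ge> d \<Longrightarrow> (T ^^ k) x = 0" and e: "\<And>k. k \<ge> e \<Longrightarrow> (T ^^ k) y = 0"
    using T(2) unfolding loc_nilp_def by metis
  let ?N = "max d e"
  have "op_exp T x = (\<Sum>k<?N. divpow T k x)" "op_exp T y = (\<Sum>k<?N. divpow T k y)"
    "op_exp T (x + y) = (\<Sum>k<?N. divpow T k (x + y))"
    using d e by (auto intro!: op_exp_eq_sum simp: lin_add[OF lin_funpow[OF T(1)]])
  then show "op_exp T (x + y) = op_exp T x + op_exp T y"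
    by (simp add: lin_add[OF lin_divpow[OF T(1)]] sum.distrib)
  have "lin (scal c :: ('a \<Rightarrow>\<^sub>0 complex) \<Rightarrow> _)"
    using lin_scaled[OF lin_ident] .
  from op_exp_intertwine[OF this _ T(2), of T x]
  show "op_exp T (scal c x) = scal c (op_exp T x)"
    by (simp add: lin_scal[OF T(1)])
qed

text \<open>The binomial theorem in divided power form. The right-hand sides \<open>E\<^sub>n\<close> satisfy the recursion
  \<open>(n + 1) E\<^bsub>n+1\<^esub> = (S + T) E\<^sub>n\<close> of the left-hand sides: in the term \<open>S\<^sup>i/i! T\<^sup>j/j!\<close> with
  \<open>i + j = n + 1\<close> the factor \<open>n + 1\<close> splits as \<open>i + j\<close>, where \<open>i\<close> comes from applying \<open>S\<close> and \<open>j\<close> from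
  applying \<open>T\<close>.\<close>

lemma divpow_add:
  assumes S: "lin S" and T: "lin T" and ST: "\<And>v. S (T v) = T (S v)"
  shows "divpow (\<lambda>v. S v + T v) n v = (\<Sum>i\<le>n. divpow S i (divpow T (n - i) v))"
proof (induction n)
  case 0
  then show ?case by simp
next
  case (Suc n)
  let ?g = "\<lambda>i j. divpow S i (divpow T j v)"
  have comm: "T (divpow S i w) = divpow S i (T w)" for i w
    using funpow_intertwine[of T S S i w] by (simp add: divpow_def ST lin_scal[OF T])
  have Tg: "T (?g i j) = scal (of_nat (Suc j)) (?g i (Suc j))" for i j
    by (simp only: comm divpow_Suc[OF T] lin_scal[OF lin_divpow[OF S]])
  have Sg: "S (?g i j) = scal (of_nat (Suc i)) (?g (Suc i) j)" for i j
    by (rule divpow_Suc[OF S])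
  have "scal (of_nat (Suc n)) (divpow (\<lambda>v. S v + T v) (Suc n) v)
      = S (\<Sum>i\<le>n. ?g i (n - i)) + T (\<Sum>i\<le>n. ?g i (n - i))"
    using divpow_Suc[OF lin_plus[OF S T]] Suc.IH by metis
  also have "\<dots> = (\<Sum>i\<le>n. scal (of_nat (Suc i)) (?g (Suc i) (n - i)))
               + (\<Sum>i\<le>n. scal (of_nat (Suc (n - i))) (?g i (Suc (n - i))))"
    by (simp only: lin_sum[OF S] lin_sum[OF T] Sg Tg)
  also have "(\<Sum>i\<le>n. scal (of_nat (Suc i)) (?g (Suc i) (n - i)))
      = (\<Sum>i\<le>Suc n. scal (of_nat i) (?g i (Suc n - i)))"
    by (subst sum.atMost_Suc_shift) simp
  also have "(\<Sum>i\<le>n. scal (of_nat (Suc (n - i))) (?g i (Suc (n - i))))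
      = (\<Sum>i\<le>Suc n. scal (of_nat (Suc n - i)) (?g i (Suc n - i)))"
    unfolding sum.atMost_Suc by (simp add: Suc_diff_le del: of_nat_Suc of_nat_diff)
  also have "(\<Sum>i\<le>Suc n. scal (of_nat i) (?g i (Suc n - i)))
        + (\<Sum>i\<le>Suc n. scal (of_nat (Suc n - i)) (?g i (Suc n - i)))
      = (\<Sum>i\<le>Suc n. scal (of_nat (Suc n)) (?g i (Suc n - i)))"
    unfolding sum.distrib[symmetric]
    by (rule sum.cong) (simp_all flip: scal_add_left of_nat_add)
  finally have "scal (of_nat (Suc n)) (divpow (\<lambda>v. S v + T v) (Suc n) v)
      = scal (of_nat (Suc n)) (\<Sum>i\<le>Suc n. ?g i (Suc n - i))"
    by (simp only: scal_sum)
  then have "scal (1 / of_nat (Suc n) * of_nat (Suc n)) (divpow (\<lambda>v. S v + T v) (Suc n) v)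
      = scal (1 / of_nat (Suc n) * of_nat (Suc n)) (\<Sum>i\<le>Suc n. ?g i (Suc n - i))"
    unfolding scal_scal[symmetric] by (rule arg_cong)
  then show ?case by (simp del: of_nat_Suc sum.atMost_Suc)
qed

text \<open>Fix \<open>v\<close>. Only finitely many \<open>T\<^sup>j v\<close> are nonzero, and \<open>S\<close> is nilpotent on each of them, so there is
  one bound \<open>N\<close> such that \<open>S\<^sup>i T\<^sup>j v\<close> vanishes outside the square \<open>i, j < N\<close>. By the binomial theorem
  \<open>(S + T)\<^sup>n v\<close> then vanishes for \<open>n \<ge> 2N\<close>, and both exponentials are the sum over that square.\<close>

lemma
  assumes S: "lin S" "loc_nilp S" and T: "lin T" "loc_nilp T" and ST: "\<And>v. S (T v) = T (S v)"
  shows loc_nilp_add: "loc_nilp (\<lambda>v. S v + T v)"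
    and op_exp_add: "op_exp (\<lambda>v. S v + T v) v = op_exp S (op_exp T v)"
proof -
  let ?g = "\<lambda>v i j. divpow S i (divpow T j v)"
  have joint: "\<exists>N. \<forall>i j. N \<le> i \<or> N \<le> j \<longrightarrow> (S ^^ i) ((T ^^ j) v) = 0" for v
  proof -
    obtain d where d: "\<And>k. k \<ge> d \<Longrightarrow> (T ^^ k) v = 0"
      using T(2) unfolding loc_nilp_def by blast
    obtain e where e: "\<And>w k. k \<ge> e w \<Longrightarrow> (S ^^ k) w = 0"
      using S(2) unfolding loc_nilp_def by metis
    let ?N = "d + (\<Sum>j<d. e ((T ^^ j) v))"
    have "(S ^^ i) ((T ^^ j) v) = 0" if "?N \<le> i \<or> ?N \<le> j" for i j
    proof (cases "j < d")
      case True
      then have "e ((T ^^ j) v) \<le> (\<Sum>j<d. e ((T ^^ j) v))"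
        by (intro member_le_sum) auto
      then show ?thesis using that True by (intro e) auto
    next
      case False
      then show ?thesis by (simp add: d lin_0[OF lin_funpow[OF S(1)]])
    qed
    then show ?thesis by blast
  qed
  have g0: "?g v i j = 0" if "(S ^^ i) ((T ^^ j) v) = 0" for v i j
    using that by (simp add: divpow_def lin_scal[OF lin_funpow[OF S(1)]])
  have vanish: "((\<lambda>v. S v + T v) ^^ n) v = 0"
    if N: "\<forall>i j. N \<le> i \<or> N \<le> j \<longrightarrow> (S ^^ i) ((T ^^ j) v) = 0" and n: "2 * N \<le> n" for N n v
  proof -
    have "divpow (\<lambda>v. S v + T v) n v = 0"
      unfolding divpow_add[OF S(1) T(1) ST]
    proof (rule sum.neutral, rule ballI)
      fix i assume "i \<in> {..n}"
      then have "N \<le> i \<or> N \<le> n - i" using n by auto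
      then show "?g v i (n - i) = 0" using N g0 by blast
    qed
    then show ?thesis by (simp add: divpow_def scal_eq_0_iff)
  qed
  show "loc_nilp (\<lambda>v. S v + T v)"
    unfolding loc_nilp_def using joint vanish by meson
  obtain N where N: "\<forall>i j. N \<le> i \<or> N \<le> j \<longrightarrow> (S ^^ i) ((T ^^ j) v) = 0"
    using joint by blast
  have lT: "op_exp T v = (\<Sum>j<N. divpow T j v)"
    using N[rule_format, of _ 0] N[rule_format, of 0] by (intro op_exp_eq_sum) simp
  have "(S ^^ i) (\<Sum>j<N. divpow T j v) = 0" if "N \<le> i" for i
    using N that by (simp add: lin_sum[OF lin_funpow[OF S(1)]] divpow_def
        lin_scal[OF lin_funpow[OF S(1)]])
  then have lS: "op_exp S (\<Sum>j<N. divpow T j v) = (\<Sum>i<N. divpow S i (\<Sum>j<N. divpow T j v))"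
    by (rule op_exp_eq_sum)
  have "op_exp (\<lambda>v. S v + T v) v = (\<Sum>n<2*N. divpow (\<lambda>v. S v + T v) n v)"
    using vanish[OF N] by (intro op_exp_eq_sum)
  also have "\<dots> = (\<Sum>n<2*N. \<Sum>i\<le>n. ?g v i (n - i))"
    by (simp add: divpow_add[OF S(1) T(1) ST])
  also have "\<dots> = (\<Sum>(i, j)\<in>{(i, j). i + j < 2*N}. ?g v i j)"
    by (rule sum.triangle_reindex[symmetric])
  also have "\<dots> = (\<Sum>(i, j)\<in>{..<N} \<times> {..<N}. ?g v i j)"
  proof (rule sum.mono_neutral_right)
    show "finite {(i, j). i + j < 2 * N}"
      by (rule finite_subset[of _ "{..<2*N} \<times> {..<2*N}"]) auto
    show "\<forall>x\<in>{(i, j). i + j < 2 * N} - {..<N} \<times> {..<N}. (case x of (i, j) \<Rightarrow> ?g v i j) = 0"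
      using N g0 by (clarsimp simp: not_less) (metis not_less)
  qed auto
  also have "\<dots> = (\<Sum>i<N. \<Sum>j<N. ?g v i j)"
    by (rule sum.cartesian_product[symmetric])
  also have "\<dots> = op_exp S (op_exp T v)"
    by (simp add: lT lS lin_sum[OF lin_divpow[OF S(1)]])
  finally show "op_exp (\<lambda>v. S v + T v) v = op_exp S (op_exp T v)" .
qed

lemma funpow_scaled:
  fixes T :: "('k \<Rightarrow>\<^sub>0 complex) \<Rightarrow> ('k \<Rightarrow>\<^sub>0 complex)"
  assumes "lin T"
  shows "((\<lambda>v. scal c (T v)) ^^ k) v = scal (c ^ k) ((T ^^ k) v)"
  by (induction k) (simp_all add: lin_scal[OF assms])

lemma loc_nilp_scaled:
  assumes "lin T" "loc_nilp T"
  shows "loc_nilp (\<lambda>v. scal c (T v))"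
  unfolding loc_nilp_def funpow_scaled[OF assms(1)]
  using assms(2) unfolding loc_nilp_def by (metis scal_0)

lemma op_exp_zero: "op_exp (\<lambda>v. 0) (v :: 'a \<Rightarrow>\<^sub>0 complex) = v"
proof -
  have "((\<lambda>v. 0 :: 'a \<Rightarrow>\<^sub>0 complex) ^^ k) v = 0" if "1 \<le> k" for k
    using that by (cases k) auto
  from op_exp_eq_sum[of 1, OF this] show ?thesis by simp
qed

lemma loc_nilpI_basis:
  assumes T: "lin T" and nil: "\<And>m. \<exists>d. \<forall>k\<ge>d. (T ^^ k) (monom m) = 0"
  shows "loc_nilp T"
  unfolding loc_nilp_def
proof
  fix v
  obtain d where d: "\<And>m k. k \<ge> d m \<Longrightarrow> (T ^^ k) (monom m) = 0"
    using nil by metis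
  have "(T ^^ k) v = 0" if k: "k \<ge> (\<Sum>m\<in>Poly_Mapping.keys v. d m)" for k
  proof -
    have "(T ^^ k) (monom m) = 0" if "m \<in> Poly_Mapping.keys v" for m
      using member_le_sum[OF that, of d] k by (intro d) auto
    then have "(T ^^ k) (lin_ext monom v) = 0"
      unfolding lin_ext_def using lin_funpow[OF T]
      by (simp add: lin_sum lin_scal)
    then show ?thesis by (simp add: lin_ext_monom_id)
  qed
  then show "\<exists>d. \<forall>k\<ge>d. (T ^^ k) v = 0" by blast
qed

text \<open>This is \<open>e\<^sup>T M e\<^bsup>-T\<^esup> = e\<^bsup>ad T\<^esup> M\<close> in the case where the series on the right stops after its linear
  term, since \<open>D = [T, M]\<close> commutes with \<open>T\<close>.\<close>

lemma op_exp_commutator: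
  assumes T: "lin T" "loc_nilp T" and M: "lin M" and D: "lin D"
    and TM: "\<And>v. T (M v) = M (T v) + D v" and TD: "\<And>v. T (D v) = D (T v)"
  shows "op_exp T (M v) = M (op_exp T v) + D (op_exp T v)"
proof -
  \<comment> \<open>The factor \<open>k + 1\<close> turns \<open>1/(k+1)!\<close> into \<open>1/k!\<close>, so \<open>D\<close> meets the series shifted by one place.\<close>
  have pow: "(T ^^ Suc k) (M w) = M ((T ^^ Suc k) w) + scal (of_nat (Suc k)) (D ((T ^^ k) w))" for k w
  proof (induction k)
    case 0
    then show ?case by (simp add: TM)
  next
    case (Suc k)
    have "(T ^^ Suc (Suc k)) (M w) = T (M ((T ^^ Suc k) w)) + scal (of_nat (Suc k)) (T (D ((T ^^ k) w)))"
      by (simp only: Suc.IH funpow.simps(2)[of "Suc k"] o_apply lin_add[OF T(1)] lin_scal[OF T(1)])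
    also have "\<dots> = M ((T ^^ Suc (Suc k)) w) + (D ((T ^^ Suc k) w) + scal (of_nat (Suc k)) (D ((T ^^ Suc k) w)))"
      by (simp add: TM TD)
    also have "D ((T ^^ Suc k) w) + scal (of_nat (Suc k)) (D ((T ^^ Suc k) w))
        = scal (of_nat (Suc (Suc k))) (D ((T ^^ Suc k) w))"
      by (subst of_nat_Suc[of "Suc k"]) (simp only: scal_add_left scal_one)
    finally show ?case .
  qed
  have dp: "divpow T (Suc k) (M w) = M (divpow T (Suc k) w) + D (divpow T k w)" for k w
    unfolding divpow_def pow
    by (simp add: scal_add_right lin_scal[OF M] lin_scal[OF D] del: funpow.simps of_nat_Suc)
  obtain d where d: "\<And>k. k \<ge> d \<Longrightarrow> (T ^^ k) v = 0"
    using T(2) unfolding loc_nilp_def by blast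
  have z: "(T ^^ k) (M v) = 0" if k: "k \<ge> Suc d" for k
  proof -
    obtain l where l: "k = Suc l" "l \<ge> d" using k by (cases k) auto
    show ?thesis unfolding l(1) pow using d[of l] d[of "Suc l"] l
      by (simp add: lin_0[OF M] lin_0[OF D] del: funpow.simps)
  qed
  have "op_exp T (M v) = (\<Sum>k<Suc d. divpow T k (M v))"
    using z by (rule op_exp_eq_sum)
  also have "\<dots> = M v + (\<Sum>k<d. divpow T (Suc k) (M v))"
    by (subst sum.lessThan_Suc_shift) simp
  also have "\<dots> = M v + (\<Sum>k<d. M (divpow T (Suc k) v)) + (\<Sum>k<d. D (divpow T k v))"
    by (simp add: dp sum.distrib add.assoc)
  also have "M v + (\<Sum>k<d. M (divpow T (Suc k) v)) = (\<Sum>k<Suc d. M (divpow T k v))"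
    by (subst sum.lessThan_Suc_shift) simp
  also have "\<dots> = M (op_exp T v)"
    using op_exp_eq_sum[of "Suc d" T v] d by (simp add: lin_sum[OF M] lin_add[OF M])
  also have "(\<Sum>k<d. D (divpow T k v)) = D (op_exp T v)"
    using op_exp_eq_sum[of d T v] d by (simp add: lin_sum[OF D])
  finally show ?thesis .
qed


section \<open>The Laplacian and its product rule\<close>

lemma scal_conv_mult: "scal c p = Poly_Mapping.single 0 c * p"
  unfolding scal_def by (rule mult_map_scale_conv_mult)

lemma scal_mult_left: "scal c (f :: 'n cpoly) * g = scal c (f * g)"
  by (simp add: scal_conv_mult mult.assoc)

lemma scal_mult_right: "(f :: 'n cpoly) * scal c g = scal c (f * g)"
  by (simp add: scal_conv_mult mult.left_commute)

lemma lin_mult_left: "lin (\<lambda>f. (h :: 'n cpoly) * f)"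
  by (rule linI) (simp_all add: distrib_left scal_mult_right)

lemma lin_mult_right: "lin (\<lambda>f. f * (h :: 'n cpoly))"
  by (rule linI) (simp_all add: distrib_right scal_mult_left)

lemma monom_mult: "monom a * monom b = (monom (a + b) :: 'n cpoly)"
  by (simp add: monom_def mult_single)

lemma lin_pderiv: "lin (pderiv_var v)"
  unfolding pderiv_var_def by (rule lin_lin_ext)

lemma pderiv_monom:
  "pderiv_var v (monom m)
     = scal (of_nat (Poly_Mapping.lookup m v)) (monom (m - Poly_Mapping.single v 1))"
  by (simp add: pderiv_var_def)

lemma pderiv_one: "pderiv_var v 1 = 0"
  using pderiv_monom[of v 0] by (simp add: monom_def)

lemma pderiv_commute: "pderiv_var v (pderiv_var w f) = pderiv_var w (pderiv_var v f)"
proof (rule lin_eqI[where F = "\<lambda>f. pderiv_var v (pderiv_var w f)"])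
  fix m :: "'a mono"
  show "pderiv_var v (pderiv_var w (monom m)) = pderiv_var w (pderiv_var v (monom m))"
  proof (cases "v = w")
    case False
    then show ?thesis
      by (simp add: pderiv_monom lin_scal[OF lin_pderiv] lookup_minus lookup_single mult.commute
          diff_right_commute[of m])
  qed simp
qed (rule lin_comp[OF lin_pderiv lin_pderiv])+

lemma pderiv_mult: "pderiv_var v (f * g) = pderiv_var v f * g + f * pderiv_var v g"
proof -
  have monoms: "pderiv_var v (monom a * monom b)
      = pderiv_var v (monom a) * monom b + monom a * pderiv_var v (monom b)" for a b :: "'a mono"
  proof -
    \<comment> \<open>Truncated subtraction commutes with addition here because \<open>v\<close> occurs in \<open>a'\<close>; in the
      other case the coefficient in front vanishes.\<close>
    have shift: "monom (a' - Poly_Mapping.single v 1 + b') = monom (a' + b' - Poly_Mapping.single v 1)"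
      if "Poly_Mapping.lookup a' v \<noteq> 0" for a' b' :: "'a mono"
      using that
      by (intro arg_cong[of _ _ monom] poly_mapping_eqI)
         (auto simp: lookup_add lookup_minus lookup_single when_def)
    have 1: "pderiv_var v (monom a) * monom b
        = scal (of_nat (Poly_Mapping.lookup a v)) (monom (a + b - Poly_Mapping.single v 1))"
      using shift[of a b] by (cases "Poly_Mapping.lookup a v = 0")
        (simp_all add: pderiv_monom scal_mult_left monom_mult)
    have 2: "monom a * pderiv_var v (monom b)
        = scal (of_nat (Poly_Mapping.lookup b v)) (monom (a + b - Poly_Mapping.single v 1))"
      using shift[of b a] by (cases "Poly_Mapping.lookup b v = 0")
        (simp_all add: pderiv_monom scal_mult_right monom_mult add.commute)
    show ?thesis
      unfolding 1 2 by (simp add: monom_mult pderiv_monom lookup_add scal_add_left)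
  qed
  have left: "pderiv_var v (f * monom b) = pderiv_var v f * monom b + f * pderiv_var v (monom b)" for b
    by (rule lin_eqI[where F = "\<lambda>f. pderiv_var v (f * monom b)"])
       (intro lin_comp[OF lin_pderiv] lin_comp[OF lin_mult_right] lin_plus lin_ident
         | rule monoms)+
  show ?thesis
    by (rule lin_eqI[where F = "\<lambda>g. pderiv_var v (f * g)"])
       (intro lin_comp[OF lin_pderiv] lin_comp[OF lin_mult_left] lin_plus lin_ident
         | rule left)+
qed

definition Lambda :: "'n::finite cpoly \<Rightarrow> 'n cpoly" where
  "Lambda f = (\<Sum>i\<in>UNIV. dz i (dxi i f))"

lemma lin_Lambda: "lin Lambda"
  unfolding Lambda_def[abs_def] by (rule lin_sum_fun) (rule lin_comp[OF lin_pderiv lin_pderiv])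

lemma Lambda_pderiv: "Lambda (pderiv_var v f) = pderiv_var v (Lambda f)"
  unfolding Lambda_def lin_sum[OF lin_pderiv] by (intro sum.cong refl) (metis pderiv_commute)

lemma deg_pderiv_less:
  assumes f: "\<And>k. k \<in> Poly_Mapping.keys f \<Longrightarrow> deg_mono k < Suc d"
    and k: "k \<in> Poly_Mapping.keys (pderiv_var v f)"
  shows "deg_mono k < d"
proof -
  obtain m where m: "m \<in> Poly_Mapping.keys f"
    and km: "k \<in> Poly_Mapping.keys (scal (of_nat (Poly_Mapping.lookup m v)) (monom (m - Poly_Mapping.single v 1)))"
    using subsetD[OF keys_lin_ext k[unfolded pderiv_var_def]] by (rule UN_E)
  have "deg_mono k < deg_mono m"
    by (rule keys_pderiv_monom) (rule km[folded pderiv_monom])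
  then show ?thesis using f[OF m] by simp
qed

lemma deg_Lambda_less:
  assumes f: "\<And>k. k \<in> Poly_Mapping.keys f \<Longrightarrow> deg_mono k < Suc d"
    and k: "k \<in> Poly_Mapping.keys (Lambda f)"
  shows "deg_mono k < d"
proof -
  obtain i where i: "k \<in> Poly_Mapping.keys (dz i (dxi i f))"
    using subsetD[OF keys_sum k[unfolded Lambda_def]] by (rule UN_E)
  show ?thesis
  proof (rule deg_pderiv_less[OF _ i])
    show "deg_mono k < Suc d" if "k \<in> Poly_Mapping.keys (dxi i f)" for k
      using deg_pderiv_less[OF f that] by simp
  qed
qed

text \<open>Every application of \<open>\<Lambda>\<close> lowers the degree, which makes \<open>\<Lambda>\<close> locally nilpotent.\<close>

lemma Lambda_funpow_eq_0:
  assumes "\<And>k. k \<in> Poly_Mapping.keys f \<Longrightarrow> deg_mono k < d"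
  shows "(Lambda ^^ d) f = 0"
  using assms
proof (induction d arbitrary: f)
  case 0
  then have "Poly_Mapping.keys f = {}" by (metis equals0I not_less_zero)
  then show ?case by simp
next
  case (Suc d)
  have "(Lambda ^^ d) (Lambda f) = 0"
    by (rule Suc.IH) (rule deg_Lambda_less[OF Suc.prems])
  then show ?case by (simp only: funpow_Suc_right o_apply)
qed

lemma loc_nilp_Lambda: "loc_nilp Lambda"
proof (rule loc_nilpI_basis[OF lin_Lambda])
  fix m :: "'a mono"
  have "(Lambda ^^ k) (monom m) = 0" if "Suc (deg_mono m) \<le> k" for k
    by (rule Lambda_funpow_eq_0) (use that in \<open>simp add: monom_def\<close>)
  then show "\<exists>d. \<forall>k\<ge>d. (Lambda ^^ k) (monom m) = 0" by blast
qed


section \<open>The tensor square\<close>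

lemma lookup_tensor:
  "Poly_Mapping.lookup (tensor f g) (a, b) = Poly_Mapping.lookup f a * Poly_Mapping.lookup g b"
proof -
  have "Poly_Mapping.lookup (tensor f g) (a, b)
      = (\<Sum>x\<in>Poly_Mapping.keys f. \<Sum>y\<in>Poly_Mapping.keys g.
          if x = a then (if y = b then Poly_Mapping.lookup f x * Poly_Mapping.lookup g y else 0) else 0)"
    unfolding tensor_def lookup_sum lookup_single when_def by (intro sum.cong refl) auto
  also have "\<dots> = (\<Sum>x\<in>Poly_Mapping.keys f. if x = a then
      (\<Sum>y\<in>Poly_Mapping.keys g. if y = b then Poly_Mapping.lookup f x * Poly_Mapping.lookup g y else 0) else 0)"
    by (intro sum.cong refl) auto
  also have "\<dots> = Poly_Mapping.lookup f a * Poly_Mapping.lookup g b"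
    by (simp add: in_keys_iff)
  finally show ?thesis .
qed

lemma lin_tensor_left: "lin (\<lambda>f. tensor f g)"
  by (rule linI; rule poly_mapping_eqI) (auto simp: lookup_tensor lookup_add algebra_simps)

lemma lin_tensor_right: "lin (\<lambda>g. tensor f g)"
  by (rule linI; rule poly_mapping_eqI) (auto simp: lookup_tensor lookup_add algebra_simps)

lemma tensor_monom: "tensor (monom a) (monom b) = monom (a, b)"
proof (rule poly_mapping_eqI)
  fix k :: "'a \<times> 'b"
  show "Poly_Mapping.lookup (tensor (monom a) (monom b)) k = Poly_Mapping.lookup (monom (a, b)) k"
    by (cases k) (simp add: lookup_tensor monom_def lookup_single when_def)
qed

lemma lin_eqI_tensor:
  assumes "lin F" "lin G" and eq: "\<And>f g. F (tensor f g) = G (tensor f g)"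
  shows "F x = G x"
proof (rule lin_eqI[OF assms(1,2)])
  show "F (monom m) = G (monom m)" for m
    using eq[of "monom (fst m)" "monom (snd m)"] by (simp only: tensor_monom prod.collapse)
qed

lemma bilin_eqI:
  assumes F: "\<And>g. lin (\<lambda>f. F f g)" "\<And>f. lin (F f)"
    and G: "\<And>g. lin (\<lambda>f. G f g)" "\<And>f. lin (G f)"
    and eq: "\<And>a b. F (monom a) (monom b) = G (monom a) (monom b)"
  shows "F f g = G f g"
proof (rule lin_eqI[OF F(2) G(2)])
  show "F f (monom b) = G f (monom b)" for b
    by (rule lin_eqI[OF F(1) G(1) eq])
qed

lemma lin_tensor_op: "lin (tensor_op A B)"
  unfolding tensor_op_def by (rule lin_lin_ext)

lemma tensor_op_tensor:
  assumes A: "lin A" and B: "lin B"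
  shows "tensor_op A B (tensor f g) = tensor (A f) (B g)"
proof (rule bilin_eqI[where F = "\<lambda>f g. tensor_op A B (tensor f g)"
      and G = "\<lambda>f g. tensor (A f) (B g)"])
  show "lin (\<lambda>f. tensor_op A B (tensor f g))" for g
    by (rule lin_comp[OF lin_tensor_op lin_tensor_left])
  show "lin (\<lambda>g. tensor_op A B (tensor f g))" for f
    by (rule lin_comp[OF lin_tensor_op lin_tensor_right])
  show "lin (\<lambda>f. tensor (A f) (B g))" for g
    by (rule lin_comp[OF lin_tensor_left A])
  show "lin (\<lambda>g. tensor (A f) (B g))" for f
    by (rule lin_comp[OF lin_tensor_right B])
  show "tensor_op A B (tensor (monom a) (monom b)) = tensor (A (monom a)) (B (monom b))" for a b
    by (simp only: tensor_monom tensor_op_def lin_ext_monom prod.case)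
qed

lemma lin_mu: "lin mu"
  unfolding mu_def by (rule lin_lin_ext)

lemma mu_tensor: "mu (tensor f g) = f * g"
proof (rule bilin_eqI[where F = "\<lambda>f g. mu (tensor f g)" and G = "\<lambda>f g. f * g"])
  show "lin (\<lambda>f. mu (tensor f g))" for g by (rule lin_comp[OF lin_mu lin_tensor_left])
  show "lin (\<lambda>g. mu (tensor f g))" for f by (rule lin_comp[OF lin_mu lin_tensor_right])
  show "mu (tensor (monom a) (monom b)) = monom a * monom b" for a b
    by (simp only: tensor_monom mu_def lin_ext_monom prod.case)
qed (rule lin_mult_left lin_mult_right)+

lemma lin_Omega: "lin Omega"
  unfolding Omega_def[abs_def] by (intro lin_sum_fun lin_plus lin_tensor_op)

lemma Omega_tensor:
  "Omega (tensor f g) = (\<Sum>i\<in>UNIV. tensor (dz i f) (dxi i g) + tensor (dxi i f) (dz i g))"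
  by (simp add: Omega_def tensor_op_tensor lin_pderiv)

lemma loc_nilp_Omega: "loc_nilp Omega"
  unfolding loc_nilp_def using Omega_nilpotent by blast

definition Lambda_fst :: "'n::finite cpoly2 \<Rightarrow> 'n cpoly2" where
  "Lambda_fst = tensor_op Lambda (\<lambda>g. g)"

definition Lambda_snd :: "'n::finite cpoly2 \<Rightarrow> 'n cpoly2" where
  "Lambda_snd = tensor_op (\<lambda>f. f) Lambda"

lemma lin_Lambda_fst: "lin Lambda_fst" and lin_Lambda_snd: "lin Lambda_snd"
  by (simp_all add: Lambda_fst_def Lambda_snd_def lin_tensor_op)

lemma Lambda_fst_tensor: "Lambda_fst (tensor f g) = tensor (Lambda f) g"
  and Lambda_snd_tensor: "Lambda_snd (tensor f g) = tensor f (Lambda g)"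
  by (simp_all add: Lambda_fst_def Lambda_snd_def tensor_op_tensor lin_Lambda lin_ident)

text \<open>On a pure tensor the powers of \<open>\<Lambda> \<otimes> 1\<close> are those of \<open>\<Lambda>\<close> in the first factor, so nilpotency is
  inherited from \<open>\<Lambda>\<close>; likewise for \<open>1 \<otimes> \<Lambda>\<close>.\<close>

lemma loc_nilp_Lambda_fst: "loc_nilp Lambda_fst"
proof (rule loc_nilpI_basis[OF lin_Lambda_fst])
  fix m :: "'a mono \<times> 'a mono"
  obtain a b where m: "m = (a, b)" by (cases m)
  obtain d where "\<forall>k\<ge>d. (Lambda ^^ k) (monom a) = 0"
    using loc_nilp_Lambda unfolding loc_nilp_def by blast
  moreover have "(Lambda_fst ^^ k) (monom m) = tensor ((Lambda ^^ k) (monom a)) (monom b)" for k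
    using funpow_intertwine[of "\<lambda>f. tensor f (monom b)" Lambda Lambda_fst, OF Lambda_fst_tensor[symmetric]]
    by (metis m tensor_monom)
  ultimately have "\<forall>k\<ge>d. (Lambda_fst ^^ k) (monom m) = 0"
    by (simp add: lin_0[OF lin_tensor_left])
  then show "\<exists>d. \<forall>k\<ge>d. (Lambda_fst ^^ k) (monom m) = 0" by blast
qed

lemma loc_nilp_Lambda_snd: "loc_nilp Lambda_snd"
proof (rule loc_nilpI_basis[OF lin_Lambda_snd])
  fix m :: "'a mono \<times> 'a mono"
  obtain a b where m: "m = (a, b)" by (cases m)
  obtain d where "\<forall>k\<ge>d. (Lambda ^^ k) (monom b) = 0"
    using loc_nilp_Lambda unfolding loc_nilp_def by blast
  moreover have "(Lambda_snd ^^ k) (monom m) = tensor (monom a) ((Lambda ^^ k) (monom b))" for k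
    using funpow_intertwine[of "\<lambda>g. tensor (monom a) g" Lambda Lambda_snd, OF Lambda_snd_tensor[symmetric]]
    by (metis m tensor_monom)
  ultimately have "\<forall>k\<ge>d. (Lambda_snd ^^ k) (monom m) = 0"
    by (simp add: lin_0[OF lin_tensor_right])
  then show "\<exists>d. \<forall>k\<ge>d. (Lambda_snd ^^ k) (monom m) = 0" by blast
qed

lemma Lambda_fst_snd_commute: "Lambda_fst (Lambda_snd T) = Lambda_snd (Lambda_fst T)"
  by (rule lin_eqI_tensor[where F = "\<lambda>T. Lambda_fst (Lambda_snd T)" and G = "\<lambda>T. Lambda_snd (Lambda_fst T)"])
     (intro lin_comp[OF lin_Lambda_fst] lin_comp[OF lin_Lambda_snd] lin_ident
      | simp add: Lambda_fst_tensor Lambda_snd_tensor)+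

lemma Lambda_fst_Omega_commute: "Lambda_fst (Omega T) = Omega (Lambda_fst T)"
  by (rule lin_eqI_tensor[where F = "\<lambda>T. Lambda_fst (Omega T)" and G = "\<lambda>T. Omega (Lambda_fst T)"])
     (intro lin_comp[OF lin_Lambda_fst] lin_comp[OF lin_Omega] lin_ident
      | simp add: Lambda_fst_tensor Omega_tensor lin_sum[OF lin_Lambda_fst]
          lin_add[OF lin_Lambda_fst] Lambda_pderiv)+

lemma Lambda_snd_Omega_commute: "Lambda_snd (Omega T) = Omega (Lambda_snd T)"
  by (rule lin_eqI_tensor[where F = "\<lambda>T. Lambda_snd (Omega T)" and G = "\<lambda>T. Omega (Lambda_snd T)"])
     (intro lin_comp[OF lin_Lambda_snd] lin_comp[OF lin_Omega] lin_ident
      | simp add: Lambda_snd_tensor Omega_tensor lin_sum[OF lin_Lambda_snd]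
          lin_add[OF lin_Lambda_snd] Lambda_pderiv)+

text \<open>Expanding \<open>\<partial>\<^sub>i \<delta>\<^sub>i (f g)\<close> by the Leibniz rule gives four terms: in two of them both derivatives
  hit the same factor, and the two mixed ones make up \<open>\<Omega>\<close>.\<close>

lemma Lambda_mu: "Lambda (mu T) = mu ((Lambda_fst T + Lambda_snd T) + Omega T)"
proof (rule lin_eqI_tensor[where F = "\<lambda>T. Lambda (mu T)"
      and G = "\<lambda>T. mu ((Lambda_fst T + Lambda_snd T) + Omega T)"])
  fix f g :: "'a cpoly"
  have "Lambda (f * g) = (Lambda f * g + f * Lambda g)
      + (\<Sum>i\<in>UNIV. dz i f * dxi i g + dxi i f * dz i g)"
    by (simp add: Lambda_def pderiv_mult lin_add[OF lin_pderiv] sum.distrib sum_distrib_left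
        sum_distrib_right algebra_simps)
  then show "Lambda (mu (tensor f g))
      = mu ((Lambda_fst (tensor f g) + Lambda_snd (tensor f g)) + Omega (tensor f g))"
    by (simp add: mu_tensor Lambda_fst_tensor Lambda_snd_tensor Omega_tensor lin_add[OF lin_mu]
        lin_sum[OF lin_mu])
qed (intro lin_comp[OF lin_Lambda] lin_comp[OF lin_mu] lin_plus lin_Lambda_fst lin_Lambda_snd
       lin_Omega lin_ident)+


section \<open>The isomorphism from the deformed to the usual algebra\<close>

definition exp_Lambda :: "complex \<Rightarrow> 'n::finite cpoly \<Rightarrow> 'n cpoly" where
  "exp_Lambda t = op_exp (\<lambda>f. scal t (Lambda f))"

lemma lin_exp_Lambda: "lin (exp_Lambda t)"
  unfolding exp_Lambda_def by (intro lin_op_exp lin_scaled loc_nilp_scaled lin_Lambda loc_nilp_Lambda)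

lemma exp_Lambda_inverse: "exp_Lambda (- t) (exp_Lambda t f) = f"
proof -
  have "exp_Lambda (- t) (exp_Lambda t f) = op_exp (\<lambda>f. scal (- t) (Lambda f) + scal t (Lambda f)) f"
    unfolding exp_Lambda_def
    by (intro op_exp_add[symmetric] lin_scaled loc_nilp_scaled lin_Lambda loc_nilp_Lambda)
       (simp add: lin_scal[OF lin_Lambda] mult.commute)
  also have "(\<lambda>f. scal (- t) (Lambda f) + scal t (Lambda f)) = (\<lambda>f. 0)"
    by (simp add: scal_minus_left)
  finally show ?thesis by (simp add: op_exp_zero)
qed

lemma exp_Lambda_inverse': "exp_Lambda t (exp_Lambda (- t) f) = f"
  using exp_Lambda_inverse[of "- t" f] by simp

lemma exp_Omega_eq_op_exp: "exp_Omega c = op_exp (\<lambda>T. scal c (Omega T))"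
  by (rule ext) (simp add: exp_Omega_def op_exp_def divpow_def funpow_scaled lin_Omega)

text \<open>Moving \<open>e\<^bsup>t\<Lambda>\<^esup>\<close> past \<open>\<mu>\<close> produces a factor \<open>e\<^bsup>t\<Omega>\<^esup>\<close>, which cancels the \<open>e\<^bsup>-t\<Omega>\<^esup>\<close> in the definition of
  \<open>\<ast>\<^sub>t\<close>.\<close>

lemma exp_Lambda_star: "exp_Lambda t (star t f g) = exp_Lambda t f * exp_Lambda t g"
proof -
  let ?L1 = "\<lambda>T. scal t (Lambda_fst T)" and ?L2 = "\<lambda>T. scal t (Lambda_snd T)"
  let ?O = "\<lambda>c T. scal c (Omega T)"
  note facts = lin_plus lin_scaled loc_nilp_scaled lin_Lambda_fst lin_Lambda_snd lin_Omega
    loc_nilp_Lambda_fst loc_nilp_Lambda_snd loc_nilp_Omega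
  note expand = lin_add[OF lin_Lambda_fst] lin_add[OF lin_Lambda_snd] lin_add[OF lin_Omega]
    lin_scal[OF lin_Lambda_fst] lin_scal[OF lin_Lambda_snd] lin_scal[OF lin_Omega]
    Lambda_fst_snd_commute Lambda_fst_Omega_commute Lambda_snd_Omega_commute
    scal_add_right mult.commute
  have nil12: "loc_nilp (\<lambda>T. ?L1 T + ?L2 T)"
    by (rule loc_nilp_add) (intro facts | simp add: expand)+
  have nil: "loc_nilp (\<lambda>T. (?L1 T + ?L2 T) + ?O t T)"
    by (rule loc_nilp_add) (intro facts nil12 | simp add: expand)+
  have left: "tensor (exp_Lambda t f) h = op_exp ?L1 (tensor f h)" for h
    unfolding exp_Lambda_def
    by (rule op_exp_intertwine[where M = "\<lambda>f. tensor f h"])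
       (intro lin_tensor_left loc_nilp_scaled lin_Lambda loc_nilp_Lambda
        | simp add: Lambda_fst_tensor lin_scal[OF lin_tensor_left])+
  have right: "tensor h (exp_Lambda t g) = op_exp ?L2 (tensor h g)" for h
    unfolding exp_Lambda_def
    by (rule op_exp_intertwine[where M = "\<lambda>g. tensor h g"])
       (intro lin_tensor_right loc_nilp_scaled lin_Lambda loc_nilp_Lambda
        | simp add: Lambda_snd_tensor lin_scal[OF lin_tensor_right])+
  have "exp_Lambda t (star t f g) = op_exp (\<lambda>f. scal t (Lambda f)) (mu (op_exp (?O (- t)) (tensor f g)))"
    by (simp add: exp_Lambda_def star_def exp_Omega_eq_op_exp)
  also have "\<dots> = mu (op_exp (\<lambda>T. (?L1 T + ?L2 T) + ?O t T) (op_exp (?O (- t)) (tensor f g)))"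
    by (rule op_exp_intertwine[symmetric])
       (intro lin_mu nil | simp add: Lambda_mu lin_add[OF lin_mu] lin_scal[OF lin_mu] scal_add_right)+
  also have "op_exp (\<lambda>T. (?L1 T + ?L2 T) + ?O t T) (op_exp (?O (- t)) (tensor f g))
      = op_exp (\<lambda>T. ((?L1 T + ?L2 T) + ?O t T) + ?O (- t) T) (tensor f g)"
    by (rule op_exp_add[symmetric]) (intro facts nil | simp add: expand)+
  also have "(\<lambda>T. ((?L1 T + ?L2 T) + ?O t T) + ?O (- t) T) = (\<lambda>T. ?L1 T + ?L2 T)"
    by (simp add: scal_minus_left)
  also have "op_exp (\<lambda>T. ?L1 T + ?L2 T) (tensor f g) = op_exp ?L1 (op_exp ?L2 (tensor f g))"
    by (rule op_exp_add) (intro facts | simp add: expand)+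
  also have "\<dots> = tensor (exp_Lambda t f) (exp_Lambda t g)"
    by (simp only: left[symmetric] right[symmetric])
  finally show ?thesis by (simp add: mu_tensor)
qed

lemma exp_Lambda_one: "exp_Lambda t 1 = 1"
proof -
  have "scal t (Lambda (1 :: 'a cpoly)) = 0"
    by (simp add: Lambda_def pderiv_one lin_0[OF lin_pderiv])
  moreover have "lin (\<lambda>f :: 'a cpoly. scal t (Lambda f))"
    by (intro lin_scaled lin_Lambda)
  ultimately have "((\<lambda>f :: 'a cpoly. scal t (Lambda f)) ^^ k) 1 = 0" if "1 \<le> k" for k
    using that by (cases k) (simp_all add: funpow_Suc_right lin_0[OF lin_funpow] del: funpow.simps)
  from op_exp_eq_sum[of 1, OF this] show ?thesis by (simp add: exp_Lambda_def)
qed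

lemma pderiv_Var: "pderiv_var v (Var w) = (if v = w then 1 else 0)"
  by (simp add: Var_def pderiv_monom lookup_single) (simp add: monom_def)

text \<open>\<open>[\<Lambda>, \<xi>\<^sub>i] = \<partial>\<^sub>i\<close>, since only \<open>\<delta>\<^sub>i\<close> sees the variable \<open>\<xi>\<^sub>i\<close>.\<close>

lemma Lambda_Xi_mult: "Lambda (Var (Xi i) * f) = Var (Xi i) * Lambda f + dz i f"
proof -
  have "dz j (dxi j (Var (Xi i) * f)) = Var (Xi i) * dz j (dxi j f) + (if j = i then dz j f else 0)" for j
    by (simp add: pderiv_mult pderiv_Var pderiv_one lin_add[OF lin_pderiv] lin_0[OF lin_pderiv])
  then show ?thesis
    by (simp add: Lambda_def sum.distrib sum_distrib_left)
qed

lemma exp_Lambda_Xi_mult: "exp_Lambda t (Var (Xi i) * f) = Var (Xi i) * exp_Lambda t f + scal t (dz i (exp_Lambda t f))"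
  unfolding exp_Lambda_def
  by (rule op_exp_commutator[where M = "\<lambda>f. Var (Xi i) * f" and D = "\<lambda>f. scal t (dz i f)"])
     (intro lin_scaled loc_nilp_scaled lin_Lambda loc_nilp_Lambda lin_mult_left lin_pderiv
      | simp add: Lambda_Xi_mult scal_add_right scal_mult_right lin_scal[OF lin_Lambda]
          lin_scal[OF lin_pderiv] Lambda_pderiv)+

text \<open>The sign: \<open>Im_subspace t\<close> belongs to \<open>\<xi> - t\<partial>\<close>, whereas conjugation by \<open>e\<^bsup>t\<Lambda>\<^esup>\<close> turns \<open>\<xi>\<close> into
  \<open>\<xi> + t\<partial>\<close>. Surjectivity holds because every family \<open>g\<^sub>i\<close> is the image of the family
  \<open>e\<^bsup>-t\<Lambda>\<^esup> g\<^sub>i\<close>.\<close>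

lemma exp_Lambda_image_xi_subspace: "exp_Lambda t ` xi_subspace = Im_subspace (- t)"
proof -
  have img: "exp_Lambda t (\<Sum>i\<in>UNIV. Var (Xi i) * f i)
      = (\<Sum>i\<in>UNIV. Var (Xi i) * exp_Lambda t (f i) - scal (- t) (dz i (exp_Lambda t (f i))))" for f :: "'a \<Rightarrow> 'a cpoly"
    by (simp add: lin_sum[OF lin_exp_Lambda] exp_Lambda_Xi_mult scal_minus_left)
  show ?thesis
  proof (intro equalityI subsetI)
    fix x :: "'a cpoly" assume "x \<in> exp_Lambda t ` xi_subspace"
    then obtain f where "x = exp_Lambda t (\<Sum>i\<in>UNIV. Var (Xi i) * f i)"
      unfolding xi_subspace_def by blast
    then show "x \<in> Im_subspace (- t)"
      unfolding img Im_subspace_def by (auto intro!: exI[of _ "\<lambda>i. exp_Lambda t (f i)"])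
  next
    fix x :: "'a cpoly" assume "x \<in> Im_subspace (- t)"
    then obtain g where g: "x = (\<Sum>i\<in>UNIV. Var (Xi i) * g i - scal (- t) (dz i (g i)))"
      unfolding Im_subspace_def by blast
    have "x = exp_Lambda t (\<Sum>i\<in>UNIV. Var (Xi i) * exp_Lambda (- t) (g i))"
      unfolding img g by (simp only: exp_Lambda_inverse')
    then show "x \<in> exp_Lambda t ` xi_subspace"
      unfolding xi_subspace_def by (rule image_eqI) (auto intro: exI[of _ "\<lambda>i. exp_Lambda (- t) (g i)"])
  qed
qed


section \<open>Transport of Mathieu subspaces\<close>

text \<open>All the data in the definition of a Mathieu subspace are algebraic, so they are transported by a
  bijection \<open>h\<close> that respects the operations. The
  closure of \<open>A\<close> under multiplication keeps the powers of an element in the domain of \<open>h\<close>.\<close>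

lemma mathieu_subspace_image:
  fixes A :: "('r, 'a, 'c) module_scheme" and B :: "('r, 'b, 'd) module_scheme"
  assumes M: "mathieu_subspace R A M"
    and groups: "abelian_group A" "abelian_group B"
    and closed: "\<one>\<^bsub>A\<^esub> \<in> carrier A" "\<And>x y. x \<in> carrier A \<Longrightarrow> y \<in> carrier A \<Longrightarrow> x \<otimes>\<^bsub>A\<^esub> y \<in> carrier A"
    and bij: "bij_betw h (carrier A) (carrier B)"
    and h_one: "h \<one>\<^bsub>A\<^esub> = \<one>\<^bsub>B\<^esub>"
    and h_mult: "\<And>x y. x \<in> carrier A \<Longrightarrow> y \<in> carrier A \<Longrightarrow> h (x \<otimes>\<^bsub>A\<^esub> y) = h x \<otimes>\<^bsub>B\<^esub> h y"
    and h_add: "\<And>x y. x \<in> carrier A \<Longrightarrow> y \<in> carrier A \<Longrightarrow> h (x \<oplus>\<^bsub>A\<^esub> y) = h x \<oplus>\<^bsub>B\<^esub> h y"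
    and h_smult: "\<And>c x. c \<in> carrier R \<Longrightarrow> x \<in> carrier A \<Longrightarrow> h (c \<odot>\<^bsub>A\<^esub> x) = c \<odot>\<^bsub>B\<^esub> h x"
  shows "mathieu_subspace R B (h ` M)"
proof -
  have sub: "submodule M R A"
    and mathieu: "\<And>a b. a \<in> carrier A \<Longrightarrow> (\<forall>m\<ge>1::nat. a [^]\<^bsub>A\<^esub> m \<in> M) \<Longrightarrow> b \<in> carrier A
      \<Longrightarrow> \<exists>N\<ge>1::nat. \<forall>m\<ge>N. b \<otimes>\<^bsub>A\<^esub> (a [^]\<^bsub>A\<^esub> m) \<in> M"
    using M unfolding mathieu_subspace_def by blast+
  interpret M: submodule M R A by (rule sub)
  have MA: "M \<subseteq> carrier A" using M.subset by simp
  have "group_hom (add_monoid A) (add_monoid B) h"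
    using groups bij h_add
    by (auto simp: group_hom_def group_hom_axioms_def hom_def bij_betw_def
        abelian_group.a_group)
  then have "subgroup (h ` M) (add_monoid B)"
    using M.subgroup_axioms by (rule group_hom.subgroup_img_is_subgroup)
  moreover have "c \<odot>\<^bsub>B\<^esub> x \<in> h ` M" if "c \<in> carrier R" "x \<in> h ` M" for c x
    using that M.smult_closed MA by (auto simp: h_smult[symmetric] subset_iff)
  ultimately have "submodule (h ` M) R B"
    by (simp add: submodule_def submodule_axioms_def)
  moreover have "\<exists>N\<ge>1::nat. \<forall>m\<ge>N. b \<otimes>\<^bsub>B\<^esub> (a [^]\<^bsub>B\<^esub> m) \<in> h ` M"
    if a: "a \<in> carrier B" "\<forall>m\<ge>1::nat. a [^]\<^bsub>B\<^esub> m \<in> h ` M" and b: "b \<in> carrier B" for a b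
  proof -
    obtain a' b' where a': "a' \<in> carrier A" "a = h a'" and b': "b' \<in> carrier A" "b = h b'"
      using a(1) b bij by (metis bij_betw_imp_surj_on imageE)
    have pow_closed: "a' [^]\<^bsub>A\<^esub> m \<in> carrier A" for m :: nat
      by (induction m) (simp_all add: nat_pow_def closed a'(1))
    have h_pow: "h (a' [^]\<^bsub>A\<^esub> m) = a [^]\<^bsub>B\<^esub> m" for m :: nat
    proof (induction m)
      case 0
      then show ?case by (simp add: nat_pow_def h_one)
    next
      case (Suc m)
      then show ?case using h_mult[OF pow_closed[of m] a'(1)] a'(2) by (simp add: nat_pow_def)
    qed
    have "\<forall>m\<ge>1::nat. a' [^]\<^bsub>A\<^esub> m \<in> M"
      using a(2) pow_closed MA bij inj_on_image_mem_iff[of h "carrier A" _ M]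
      unfolding h_pow[symmetric] bij_betw_def by blast
    then obtain N :: nat where "N \<ge> 1" "\<forall>m\<ge>N. b' \<otimes>\<^bsub>A\<^esub> (a' [^]\<^bsub>A\<^esub> m) \<in> M"
      using mathieu a'(1) b'(1) by blast
    moreover have "b \<otimes>\<^bsub>B\<^esub> (a [^]\<^bsub>B\<^esub> m) = h (b' \<otimes>\<^bsub>A\<^esub> (a' [^]\<^bsub>A\<^esub> m))" for m :: nat
      by (simp add: h_mult b' pow_closed h_pow)
    ultimately show ?thesis by auto
  qed
  ultimately show ?thesis unfolding mathieu_subspace_def by blast
qed

lemma abelian_group_A_alg: "abelian_group A_alg"
  by (rule abelian_groupI) (auto simp: A_alg_def ac_simps intro: exI[of _ "- _"])

lemma abelian_group_B_alg: "abelian_group (B_alg t)"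
  by (rule abelian_groupI) (auto simp: B_alg_def ac_simps intro: exI[of _ "- _"])

lemma mathieu_xi_subspace_iff:
  "mathieu_subspace complex_field (B_alg t) (xi_subspace :: 'n::finite cpoly set)
     \<longleftrightarrow> mathieu_subspace complex_field A_alg (Im_subspace (- t) :: 'n cpoly set)"
proof
  have bij: "bij (exp_Lambda s :: 'n cpoly \<Rightarrow> _)" for s
    by (rule bij_betwI[where g = "exp_Lambda (- s)"]) (simp_all add: exp_Lambda_inverse exp_Lambda_inverse')
  let ?A = "A_alg :: (complex, 'n cpoly) module" and ?B = "B_alg t :: (complex, 'n cpoly) module"
  {
    assume "mathieu_subspace complex_field ?B xi_subspace"
    then have "mathieu_subspace complex_field ?A (exp_Lambda t ` xi_subspace)"
      by (rule mathieu_subspace_image[OF _ abelian_group_B_alg abelian_group_A_alg])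
         (simp_all add: A_alg_def B_alg_def bij exp_Lambda_one exp_Lambda_star lin_add[OF lin_exp_Lambda] lin_scal[OF lin_exp_Lambda])
    then show "mathieu_subspace complex_field ?A (Im_subspace (- t))"
      by (simp add: exp_Lambda_image_xi_subspace)
  next
    assume "mathieu_subspace complex_field ?A (Im_subspace (- t))"
    moreover have "exp_Lambda (- t) (f * g) = star t (exp_Lambda (- t) f) (exp_Lambda (- t) g)" for f g :: "'n cpoly"
      using exp_Lambda_star[of t "exp_Lambda (- t) f" "exp_Lambda (- t) g"] by (metis exp_Lambda_inverse exp_Lambda_inverse')
    ultimately have "mathieu_subspace complex_field ?B (exp_Lambda (- t) ` Im_subspace (- t))"
      by (intro mathieu_subspace_image[OF _ abelian_group_A_alg abelian_group_B_alg])
         (simp_all add: A_alg_def B_alg_def bij exp_Lambda_one lin_add[OF lin_exp_Lambda] lin_scal[OF lin_exp_Lambda])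
    moreover have "exp_Lambda (- t) ` Im_subspace (- t) = (xi_subspace :: 'n cpoly set)"
      by (simp add: image_image exp_Lambda_inverse flip: exp_Lambda_image_xi_subspace)
    ultimately show "mathieu_subspace complex_field ?B xi_subspace" by simp
  }
qed

theorem theorem4p6:
  shows "(\<forall>t::complex. mathieu_subspace complex_field (B_alg t) (xi_subspace :: 'n::finite cpoly set))
     \<longleftrightarrow> (\<forall>t::complex. mathieu_subspace complex_field A_alg (Im_subspace t :: 'n cpoly set))"
  \<comment> \<open>\<open>t \<mapsto> -t\<close> permutes the parameters.\<close>
  unfolding mathieu_xi_subspace_iff by (metis minus_minus)

end
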